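(* Let $m\geq 0$ and $p$ be integers with $0\leq p\leq 2m$. Then $$\frac{\pi^{p-2m}(-1)^m e^{-i\pi p/2}}{\Gamma(1+p)}\sum_{k=0}^{\infty}\frac{(-1)^pE_{-p}\bigl(i\pi(k+\frac12)\bigr)+E_{-p}\bigl(-i\pi(k+\frac12)\bigr)}{(k+\frac12)^{2m-p}}=-\sum_{j=\lfloor -p/2+m+1/2\rfloor}^{m}\frac{\mathcal{E}(2j)}{\Gamma(2m-2j+1)\,\Gamma(2j+1)}.$$
   Context: $\mathcal{E}(n)$ denotes the $n$-th Euler number, $1/\cosh x=\sum_{n\ge0}\mathcal{E}(n)x^n/n!$ (so $\mathcal{E}(0)=1$, $\mathcal{E}(2)=-1$, $\mathcal{E}(4)=5$). $E_s(z)$ is the (generalized) exponential integral: for $z=\pm i\kappa$ with $\kappa>0$, $E_s(z)=\int_1^\infty v^{-s}e^{-zv}\,dv$ (improper integral, convergent for $\Re(s)>0$), extended to all $s\in\mathbb{C}$ by analytic continuation in $s$; equivalently $E_s(z)=z^{s-1}\Gamma(1-s,z)$ with principal branches. The infinite series is understood as a (possibly conditionally) convergent series. *)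

theory Defs
  imports "HOL-Complex_Analysis.Complex_Analysis"
begin

definition euler_number :: "nat \<Rightarrow> complex" where
  "euler_number n = fact n * fps_nth (fps_expansion (\<lambda>z. 1 / cosh z) 0) n"

(* The improper integral is the limit of the integrals over [1, T]. For nonzero z with Re z \<ge> 0
   it converges for all s with Re s > 0 and has a unique entire continuation in s; no meaning is
   attached to exp_integral s z for other z. *)
definition exp_integral :: "complex \<Rightarrow> complex \<Rightarrow> complex" where
  "exp_integral s z =
     (THE F. F holomorphic_on UNIV \<and>
        (\<forall>w. Re w > 0 \<longrightarrow>
           ((\<lambda>T. integral {1..T} (\<lambda>v. of_real v powr (- w) * exp (- z * of_real v)))
              \<longlongrightarrow> F w) at_top)) s"

end

theory Submission
  imports Defs
begin

text \<open>
  At a non-positive integer the exponential integral is elementary: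
  \<open>E\<^sub>-\<^sub>p(z) = exp (- z) * (\<Sum>l\<le>p. p! / (p - l)! / z ^ (l + 1))\<close>, by the recurrence
  \<open>E\<^sub>s(z) = exp (- z) / z - s / z * E\<^sub>s\<^sub>+\<^sub>1(z)\<close> (\<open>exp_integral_rec\<close>, \<open>exp_integral_neg_nat\<close>). The recurrence is
  integration by parts, and it also supplies the analytic continuation in \<open>s\<close>: the improper
  integral is holomorphic for \<open>Re s > 1\<close>, and each use of the recurrence extends it by one unit
  to the left. The identity theorem then shows that this is the function in the definition
  (\<open>exp_integral_eq_entire\<close>).
  
  At \<open>z = \<plusminus>\<i> pi (k + 1/2)\<close> the exponential is \<open>\<mp>\<i> (- 1) ^ k\<close>, so the symmetric combination in the
  theorem is \<open>(- 1) ^ k\<close> times a polynomial in \<open>1 / (k + 1/2)\<close> in which only every second power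
  survives (\<open>exp_integral_pair\<close>). Dividing by \<open>(k + 1/2) ^ (2 m - p)\<close> leaves odd exponents
  \<open>2 (m - q) + 1\<close> with \<open>0 \<le> q \<le> p div 2\<close>, and the sum over \<open>k\<close> becomes a finite combination of
  the classical values (\<open>sums_alternating_half_power\<close>)
  \<open>(\<Sum>k. (- 1) ^ k / (k + 1/2) ^ (2 r + 1)) = (- 1) ^ r * pi ^ (2 r + 1) * euler_number (2 r) / (2 * (2 r)!)\<close>.
  The index \<open>j = m - q\<close> gives the right-hand side.
  
  The classical values come from the partial fractions of \<open>1 / cosh\<close>, in the form of an
  identity of Digamma functions: the logarithmic derivative of Euler's reflection formula
  expresses the cotangent by Digamma functions, and a secant is a sum of two cotangents
  (\<open>sech_eq_Digamma\<close>). Differentiating \<open>2 r\<close> times at the origin turns Euler numbers into the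
  difference of Polygamma values at \<open>3/4\<close> and \<open>1/4\<close> (\<open>euler_number_even_Polygamma\<close>), whose series
  expansion is the alternating series with consecutive terms paired.
\<close>

section \<open>The exponential integral as an entire function of its order\<close>

definition truncated_ei :: "complex \<Rightarrow> real \<Rightarrow> complex \<Rightarrow> complex" where
  "truncated_ei z T w = integral {1..T} (\<lambda>v. of_real v powr (- w) * exp (- z * of_real v))"

definition improper_ei :: "complex \<Rightarrow> complex \<Rightarrow> complex" where
  "improper_ei z w = integral {1..} (\<lambda>v. of_real v powr (- w) * exp (- z * of_real v))"

lemma norm_exp_integrand_le:
  assumes "Re z \<ge> 0" "v \<ge> 1" "c \<le> Re w"
  shows "norm (of_real v powr (- w) * exp (- z * of_real v)) \<le> v powr (- c)"
proof -
  have "norm (of_real v powr (- w) * exp (- z * of_real v)) = v powr (- Re w) * exp (- (Re z * v))"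
    using assms by (simp add: norm_mult norm_powr_real_powr)
  also have "\<dots> \<le> v powr (- c) * 1"
    using assms by (intro mult_mono powr_mono) auto
  finally show ?thesis by simp
qed

lemma continuous_on_exp_integrand:
  "continuous_on {1..} (\<lambda>v::real. of_real v powr (- w) * exp (- z * of_real v) :: complex)"
  by (intro continuous_intros) auto

lemma exp_integrand_integrable:
  "a \<ge> 1 \<Longrightarrow> (\<lambda>v::real. of_real v powr (- w) * exp (- z * of_real v) :: complex) integrable_on {a..b}"
  by (rule integrable_continuous_interval, rule continuous_on_subset[OF continuous_on_exp_integrand]) auto

lemma exp_integrand_absolutely_integrable_tail:
  assumes "Re z \<ge> 0" "a \<ge> 1" "Re w > 1"
  shows "(\<lambda>v::real. of_real v powr (- w) * exp (- z * of_real v) :: complex) absolutely_integrable_on {a..}"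
proof (rule measurable_bounded_by_integrable_imp_absolutely_integrable)
  show "(\<lambda>v::real. of_real v powr (- w) * exp (- z * of_real v) :: complex) \<in> borel_measurable (lebesgue_on {a..})"
    by (rule continuous_imp_measurable_on_sets_lebesgue, 
        rule continuous_on_subset[OF continuous_on_exp_integrand]) (use assms in auto)
  show "(\<lambda>v::real. v powr (- Re w)) integrable_on {a..}"
    using has_integral_powr_to_inf[of "- Re w" a] assms by (auto simp: integrable_on_def)
qed (use assms norm_exp_integrand_le in auto)

lemma truncated_ei_holomorphic: "truncated_ei z T holomorphic_on UNIV"
proof -
  have "(\<lambda>w. integral (cbox 1 T) (\<lambda>v. of_real v powr (- w) * exp (- z * of_real v))) holomorphic_on UNIV"
  proof (rule leibniz_rule_holomorphic)
    fix w :: complex and t :: real assume "t \<in> cbox 1 T"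
    thus "((\<lambda>w. of_real t powr (- w) * exp (- z * of_real t)) has_field_derivative
        - of_real (ln t) * of_real t powr (- w) * exp (- z * of_real t)) (at w within UNIV)"
      by (auto intro!: derivative_eq_intros simp: powr_def Ln_of_real mult_ac)
  next
    show "continuous_on (UNIV \<times> cbox 1 T) (\<lambda>(w::complex, t). - of_real (ln t) * of_real t powr (- w) * exp (- z * of_real t))"
      unfolding case_prod_unfold by (intro continuous_intros) auto
  qed (use exp_integrand_integrable[of 1] in auto)
  thus ?thesis by (simp add: truncated_ei_def[abs_def] cbox_interval)
qed

text \<open>
  The bound does not depend on \<open>w\<close>; this uniformity is what makes the improper integral
  holomorphic in its exponent.
\<close>

lemma norm_improper_minus_truncated_le:
  assumes "Re z \<ge> 0" "T \<ge> 1" "1 < c" "c \<le> Re w"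
  shows "norm (improper_ei z w - truncated_ei z T w) \<le> T powr (1 - c) / (c - 1)"
proof -
  let ?f = "\<lambda>v::real. of_real v powr (- w) * exp (- z * of_real v) :: complex"
  have i1: "?f integrable_on {T..}"
    using exp_integrand_absolutely_integrable_tail[of z T w] assms set_lebesgue_integral_eq_integral(1) by auto
  have "(?f has_integral (truncated_ei z T w + integral {T..} ?f)) ({1..T} \<union> {T..})"
    unfolding truncated_ei_def
    by (rule has_integral_Un) (use i1 exp_integrand_integrable assms in \<open>auto intro!: integrable_integral simp: Int_atLeastAtMostL2\<close>)
  also have "{1..T} \<union> {T..} = {1..}" using assms by auto
  finally have "improper_ei z w = truncated_ei z T w + integral {T..} ?f"
    unfolding improper_ei_def by (rule integral_unique)
  moreover have "norm (integral {T..} ?f) \<le> integral {T..} (\<lambda>v. v powr (- c))"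
    using i1 has_integral_powr_to_inf[of "-c" T] assms
    by (intro integral_norm_bound_integral norm_exp_integrand_le) (auto simp: integrable_on_def)
  moreover have "integral {T..} (\<lambda>v. v powr (- c)) = T powr (1 - c) / (c - 1)"
  proof -
    have "integral {T..} (\<lambda>v. v powr (- c)) = - (T powr (- c + 1)) / (- c + 1)"
      using has_integral_powr_to_inf[of "-c" T] assms by (intro integral_unique) auto
    also have "\<dots> = T powr (1 - c) / (c - 1)"
      by (simp add: divide_simps) (auto simp: algebra_simps)
    finally show ?thesis .
  qed
  ultimately show ?thesis by simp
qed

lemma truncated_ei_uniform_limit:
  assumes "Re z \<ge> 0" "1 < c"
  shows "uniform_limit {w. c \<le> Re w} (truncated_ei z) (improper_ei z) at_top"
proof (rule uniform_limitI)
  fix e :: real assume "e > 0"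
  have "((\<lambda>T. T powr (1 - c) / (c - 1)) \<longlongrightarrow> 0 / (c - 1)) at_top"
    by (intro tendsto_intros tendsto_neg_powr filterlim_ident) (use assms in auto)
  hence "eventually (\<lambda>T. T powr (1 - c) / (c - 1) < e) at_top"
    using \<open>e > 0\<close> by (auto simp: order_tendsto_iff)
  with eventually_ge_at_top[of 1]
  show "eventually (\<lambda>T. \<forall>w\<in>{w. c \<le> Re w}. dist (truncated_ei z T w) (improper_ei z w) < e) at_top"
  proof eventually_elim
    case (elim T)
    show ?case
      using norm_improper_minus_truncated_le[OF assms(1) elim(1) assms(2)] elim(2)
      by (force simp: dist_norm norm_minus_commute)
  qed
qed

lemma improper_ei_holomorphic:
  assumes "Re z \<ge> 0"
  shows "improper_ei z holomorphic_on {w. Re w > 1}"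
proof -
  have op: "open {w. Re w > 1}" by (rule open_halfspace_Re_gt)
  have "improper_ei z field_differentiable (at w)" if w: "Re w > 1" for w
  proof -
    define r where "r = (Re w - 1) / 2"
    have r: "r > 0" using w by (simp add: r_def)
    have sub: "cball w r \<subseteq> {u. 1 + r \<le> Re u}"
    proof
      fix u assume "u \<in> cball w r"
      hence "\<bar>Re (w - u)\<bar> \<le> r" using abs_Re_le_cmod[of "w - u"] by (auto simp: dist_norm)
      hence "Re w - Re u \<le> r" by simp
      thus "u \<in> {u. 1 + r \<le> Re u}" unfolding r_def mem_Collect_eq by argo
    qed
    have lim: "uniform_limit (cball w r) (truncated_ei z) (improper_ei z) at_top"
      by (rule uniform_limit_on_subset[OF truncated_ei_uniform_limit sub]) (use assms r in auto)
    have "improper_ei z holomorphic_on ball w r"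
      by (rule holomorphic_uniform_limit[OF _ lim])
         (auto intro!: always_eventually holomorphic_on_imp_continuous_on 
               holomorphic_on_subset[OF truncated_ei_holomorphic])
    thus ?thesis using r by (auto intro: holomorphic_on_imp_differentiable_at)
  qed
  thus ?thesis using op by (auto simp: holomorphic_on_def field_differentiable_at_within)
qed

text \<open>
  Integration by parts with \<open>- exp (- z * v) / z\<close> as antiderivative of the exponential. The
  integrand on the right decays one power faster, so the identity carries convergence and
  holomorphy one unit to the left in \<open>w\<close>.
\<close>

lemma truncated_ei_parts:
  assumes "z \<noteq> 0" "T \<ge> 1"
  shows "truncated_ei z T w =
    (exp (- z) - of_real T powr (- w) * exp (- z * of_real T)) / z - w / z * truncated_ei z T (w + 1)"
proof -
  let ?f = "\<lambda>w v::real. of_real v powr (- w) * exp (- z * of_real v) :: complex"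
  define G where "G = (\<lambda>v::real. - (?f w v) / z)"
  have "((\<lambda>v. ?f w v + w / z * ?f (w + 1) v) has_integral (G T - G 1)) {1..T}"
  proof (rule fundamental_theorem_of_calculus)
    fix v :: real assume v: "v \<in> {1..T}"
    have p: "of_real v powr (- (w + 1)) = of_real v powr (- w) / (of_real v :: complex)"
      using v powr_diff[of "of_real v :: complex" "-w" 1] unfolding minus_add_distrib by simp
    have "((\<lambda>u. - (u powr (- w) * exp (- z * u)) / z) has_field_derivative 
       ?f w v + w / z * ?f (w + 1) v) (at (of_real v))"
      unfolding p using v assms
      by (auto intro!: derivative_eq_intros simp: field_simps complex_nonpos_Reals_iff powr_diff)
    from has_vector_derivative_real_field[OF this]
    show "(G has_vector_derivative (?f w v + w / z * ?f (w + 1) v)) (at v within {1..T})"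
      by (simp add: G_def o_def)
  qed (use assms in auto)
  moreover have "((\<lambda>v. ?f w v + w / z * ?f (w + 1) v) has_integral 
      (truncated_ei z T w + w / z * truncated_ei z T (w + 1))) {1..T}"
    unfolding truncated_ei_def
    by (intro has_integral_add has_integral_mult_right integrable_integral exp_integrand_integrable) auto
  ultimately have "truncated_ei z T w + w / z * truncated_ei z T (w + 1) = G T - G 1"
    using has_integral_unique by blast
  also have "G T - G 1 = (exp (- z) - of_real T powr (- w) * exp (- z * of_real T)) / z"
    using assms by (simp add: G_def field_simps)
  finally show ?thesis by (simp add: algebra_simps)
qed

text \<open>
  Integrating by parts once turns the possibly only conditionally convergent integral for \<open>0 < Re w \<le> 1\<close>
  into an absolutely convergent one, plus a boundary term of size \<open>T powr (- Re w)\<close>.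
\<close>

lemma truncated_ei_tendsto:
  assumes "Re z \<ge> 0" "z \<noteq> 0" "Re w > 0"
  shows "((\<lambda>T. truncated_ei z T w) \<longlongrightarrow> exp (- z) / z - w / z * improper_ei z (w + 1)) at_top"
proof -
  have "((\<lambda>T. truncated_ei z T (w + 1)) \<longlongrightarrow> improper_ei z (w + 1)) at_top"
    by (rule tendsto_uniform_limitI[OF truncated_ei_uniform_limit[of z "Re w + 1"]]) (use assms in auto)
  moreover have "((\<lambda>T::real. of_real T powr (- w) * exp (- z * of_real T)) \<longlongrightarrow> 0) at_top"
  proof (rule Lim_null_comparison)
    show "((\<lambda>T. T powr (- Re w)) \<longlongrightarrow> 0) at_top"
      by (intro tendsto_neg_powr filterlim_ident) (use assms in auto)
    show "\<forall>\<^sub>F T in at_top. norm (of_real T powr (- w) * exp (- z * of_real T)) \<le> T powr (- Re w)"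
      using eventually_ge_at_top[of 1] by eventually_elim (intro norm_exp_integrand_le assms; simp)
  qed
  ultimately have "((\<lambda>T. (exp (- z) - of_real T powr (- w) * exp (- z * of_real T)) / z - w / z * truncated_ei z T (w + 1))
     \<longlongrightarrow> (exp (- z) - 0) / z - w / z * improper_ei z (w + 1)) at_top"
    by (intro tendsto_intros) (use assms in auto)
  moreover have "\<forall>\<^sub>F T in at_top. (exp (- z) - of_real T powr (- w) * exp (- z * of_real T)) / z - w / z * truncated_ei z T (w + 1) = truncated_ei z T w"
    using eventually_ge_at_top[of 1] by eventually_elim (simp add: truncated_ei_parts[OF assms(2), of _ w])
  ultimately show ?thesis using tendsto_cong by fastforce
qed

text \<open>
  The \<open>n\<close>-th stage of the analytic continuation, obtained by reading the integration by parts
  formula as a definition; it is meaningful for \<open>Re w > 1 - n\<close>.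
\<close>

primrec continued_ei :: "complex \<Rightarrow> nat \<Rightarrow> complex \<Rightarrow> complex" where
  "continued_ei z 0 w = improper_ei z w"
| "continued_ei z (Suc n) w = exp (- z) / z - w / z * continued_ei z n (w + 1)"

lemma continued_ei_holomorphic:
  assumes "Re z \<ge> 0" "z \<noteq> 0"
  shows "continued_ei z n holomorphic_on {w. Re w > 1 - real n}"
proof (induction n)
  case 0
  show ?case using improper_ei_holomorphic[OF assms(1)] by (simp add: continued_ei.simps(1)[abs_def])
next
  case (Suc n)
  have "(continued_ei z n \<circ> (\<lambda>w. w + 1)) holomorphic_on {w. Re w > 1 - real (Suc n)}"
    by (rule holomorphic_on_compose_gen[OF _ Suc.IH]) (auto intro!: holomorphic_intros)
  thus ?case using assms
    unfolding continued_ei.simps(2)[abs_def] by (intro holomorphic_intros) (auto simp: o_def)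
qed

text \<open>
  For \<open>n = 0\<close> both sides are limits of the same truncated integrals; applying the recursion
  to this identity shifts it to the left.
\<close>

lemma continued_ei_step:
  assumes "Re z \<ge> 0" "z \<noteq> 0" "Re w > 1 - real n"
  shows "continued_ei z (Suc n) w = continued_ei z n w"
  using assms(3)
proof (induction n arbitrary: w)
  case 0
  have "((\<lambda>T. truncated_ei z T w) \<longlongrightarrow> improper_ei z w) at_top"
    by (rule tendsto_uniform_limitI[OF truncated_ei_uniform_limit[of z "Re w"]]) (use assms 0 in auto)
  with truncated_ei_tendsto[OF assms(1,2), of w] 0 show ?case
    using tendsto_unique[OF trivial_limit_at_top_linorder] by fastforce
next
  case (Suc n)
  have "continued_ei z (Suc n) (w + 1) = continued_ei z n (w + 1)" using Suc.prems by (intro Suc.IH) auto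
  thus ?case by (metis continued_ei.simps(2))
qed

lemma continued_ei_eq:
  assumes "Re z \<ge> 0" "z \<noteq> 0" "Re w > 1 - real n" "n \<le> k"
  shows "continued_ei z k w = continued_ei z n w"
  using assms(4)
proof (induction k rule: dec_induct)
  case (step k)
  thus ?case using continued_ei_step[OF assms(1,2), where n = k and w = w] assms(3) by auto
qed auto

text \<open>
  The stage \<open>\<lceil>2 - Re w\<rceil>\<close> is merely one that is certain to be meaningful at \<open>w\<close>: it makes
  \<open>1 - n\<close> at most \<open>Re w - 1\<close>.
\<close>

definition entire_ei :: "complex \<Rightarrow> complex \<Rightarrow> complex" where
  "entire_ei z w = continued_ei z (nat \<lceil>2 - Re w\<rceil>) w"

lemma entire_ei_eq_ext:
  assumes "Re z \<ge> 0" "z \<noteq> 0" "Re w > 1 - real n"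
  shows "entire_ei z w = continued_ei z n w"
proof -
  define k where "k = nat \<lceil>2 - Re w\<rceil>"
  have "Re w > 1 - real k" unfolding k_def by linarith
  thus ?thesis unfolding entire_ei_def k_def[symmetric]
    using continued_ei_eq[OF assms(1,2), of n w k] continued_ei_eq[OF assms(1,2), of k w n] assms(3)
    by (cases "n \<le> k") auto
qed

lemma entire_ei_rec:
  assumes "Re z \<ge> 0" "z \<noteq> 0"
  shows "entire_ei z w = exp (- z) / z - w / z * entire_ei z (w + 1)"
proof -
  define n where "n = nat \<lceil>2 - Re w\<rceil>"
  have "Re w > 1 - real n" unfolding n_def by linarith
  thus ?thesis
    using entire_ei_eq_ext[OF assms, of "Suc n" w] entire_ei_eq_ext[OF assms, of n "w + 1"] by simp
qed

lemma entire_ei_holomorphic: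
  assumes "Re z \<ge> 0" "z \<noteq> 0"
  shows "entire_ei z holomorphic_on UNIV"
proof -
  have "entire_ei z holomorphic_on (\<Union>n. {w. Re w > 1 - real n})"
  proof (rule holomorphic_on_UN_open)
    fix n :: nat
    show "entire_ei z holomorphic_on {w. Re w > 1 - real n}"
      by (rule holomorphic_transform[OF continued_ei_holomorphic[OF assms, of n]])
         (use entire_ei_eq_ext[OF assms] in auto)
  qed (auto intro: open_halfspace_Re_gt)
  moreover have "(\<Union>n. {w. Re w > 1 - real n}) = UNIV"
  proof -
    have "\<exists>n. Re w > 1 - real n" for w
      using reals_Archimedean2[of "1 - Re w"] by (auto simp: algebra_simps)
    thus ?thesis by auto
  qed
  ultimately show ?thesis by simp
qed

text \<open>
  The definite description in \<^const>\<open>exp_integral\<close> denotes something because the function just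
  constructed satisfies it, and only that function does, by the identity theorem.
\<close>

lemma exp_integral_eq_entire:
  assumes "Re z \<ge> 0" "z \<noteq> 0"
  shows "exp_integral s z = entire_ei z s"
proof -
  have lim: "((\<lambda>T. integral {1..T} (\<lambda>v. of_real v powr (- w) * exp (- z * of_real v))) 
     \<longlongrightarrow> entire_ei z w) at_top" if "Re w > 0" for w
    using truncated_ei_tendsto[OF assms that] entire_ei_eq_ext[OF assms, of 1 w] that
    by (simp add: truncated_ei_def)
  have "(THE F. F holomorphic_on UNIV \<and>
        (\<forall>w. Re w > 0 \<longrightarrow>
           ((\<lambda>T. integral {1..T} (\<lambda>v. of_real v powr (- w) * exp (- z * of_real v)))
              \<longlongrightarrow> F w) at_top)) = entire_ei z"
  proof (rule the_equality)
    fix F assume F: "F holomorphic_on UNIV \<and>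
        (\<forall>w. Re w > 0 \<longrightarrow>
           ((\<lambda>T. integral {1..T} (\<lambda>v. of_real v powr (- w) * exp (- z * of_real v)))
              \<longlongrightarrow> F w) at_top)"
    have "F w = entire_ei z w" if "w \<in> {w. Re w > 0}" for w
      using tendsto_unique[OF trivial_limit_at_top_linorder _ lim] F that by auto
    show "F = entire_ei z"
    proof
      fix u
      show "F u = entire_ei z u"
      proof (rule analytic_continuation_open[of "{w. Re w > 0}" UNIV F "entire_ei z"])
        show "{w. Re w > 0} \<noteq> {}" by (auto intro: exI[of _ 1])
      qed (use F entire_ei_holomorphic[OF assms] \<open>\<And>w. w \<in> {w. Re w > 0} \<Longrightarrow> F w = entire_ei z w\<close>
          in \<open>auto intro: open_halfspace_Re_gt\<close>)
    qed
  qed (use lim entire_ei_holomorphic[OF assms] in auto)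
  thus ?thesis by (simp add: exp_integral_def)
qed

lemma exp_integral_rec:
  assumes "Re z \<ge> 0" "z \<noteq> 0"
  shows "exp_integral s z = exp (- z) / z - s / z * exp_integral (s + 1) z"
  using entire_ei_rec[OF assms, of s] exp_integral_eq_entire[OF assms] by simp

text \<open>
  At \<open>s = 0\<close> the factor \<open>s / z\<close> removes the second term of the recurrence, so that at
  non-positive integers the recurrence terminates.
\<close>

lemma exp_integral_neg_nat:
  assumes "Re z \<ge> 0" "z \<noteq> 0"
  shows "exp_integral (- of_nat p) z = exp (- z) * (\<Sum>l\<le>p. fact p / fact (p - l) / z ^ (l + 1))"
proof (induction p)
  case 0
  show ?case using exp_integral_rec[OF assms, of 0] by simp
next
  case (Suc p)
  have "exp_integral (- of_nat (Suc p)) z = exp (- z) / z + of_nat (Suc p) / z * exp_integral (- of_nat p) z"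
    using exp_integral_rec[OF assms, of "- of_nat (Suc p)"] by (simp add: divide_simps) (simp add: algebra_simps)
  also have "\<dots> = exp (- z) * (1 / z + (\<Sum>l\<le>p. of_nat (Suc p) / z * (fact p / fact (p - l) / z ^ (l + 1))))"
    unfolding Suc.IH by (simp add: algebra_simps sum_distrib_left)
  also have "1 / z + (\<Sum>l\<le>p. of_nat (Suc p) / z * (fact p / fact (p - l) / z ^ (l + 1))) =
    (\<Sum>l\<le>Suc p. fact (Suc p) / fact (Suc p - l) / z ^ (l + 1))"
    unfolding sum.atMost_Suc_shift by (intro arg_cong2[of _ _ _ _ "(+)"] sum.cong) (simp_all del: of_nat_Suc fact_Suc add: fact_Suc[of p])
  finally show ?case .
qed

section \<open>Euler numbers and alternating series over the half-integers\<close>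

text \<open>
  The logarithmic derivative of \<open>Gamma z * Gamma (1 - z) = pi / sin (pi * z)\<close>.
\<close>

lemma Digamma_reflection:
  fixes z :: complex
  assumes "z \<notin> \<int>"
  shows "Digamma (1 - z) - Digamma z = of_real pi * cot (of_real pi * z)"
proof -
  have nz: "z \<notin> \<int>\<^sub>\<le>\<^sub>0" "1 - z \<notin> \<int>\<^sub>\<le>\<^sub>0"
    using assms Ints_diff[of 1 "1 - z"] by (auto dest: nonpos_Ints_Int)
  have s: "sin (of_real pi * z) \<noteq> 0"
  proof
    assume "sin (of_real pi * z) = 0"
    then obtain n where "of_real pi * z = of_real (real_of_int n * pi)"
      using sin_eq_0[of "of_real pi * z"] by auto
    hence "of_real pi * z = of_real pi * of_int n" by simp
    hence "z = of_int n" by (subst (asm) mult_cancel_left) auto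
    thus False using assms by auto
  qed
  have "((\<lambda>z. Gamma z * Gamma (1 - z)) has_field_derivative 
          Gamma z * Gamma (1 - z) * (Digamma z - Digamma (1 - z))) (at z)"
    using nz by (auto intro!: derivative_eq_intros simp: algebra_simps)
  moreover have "((\<lambda>z. Gamma z * Gamma (1 - z)) has_field_derivative 
          - (of_real pi / sin (of_real pi * z)) * (of_real pi * cot (of_real pi * z))) (at z)"
    unfolding Gamma_reflection_complex using s
    by (auto intro!: derivative_eq_intros simp: cot_def power2_eq_square)
  ultimately have "(of_real pi / sin (of_real pi * z)) * (Digamma z - Digamma (1 - z)) =
      (of_real pi / sin (of_real pi * z)) * - (of_real pi * cot (of_real pi * z))"
    unfolding Gamma_reflection_complex using DERIV_unique by fastforce
  hence "Digamma z - Digamma (1 - z) = - (of_real pi * cot (of_real pi * z))"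
    by (subst (asm) mult_left_cancel) (use s in auto)
  thus ?thesis by (metis minus_diff_eq minus_minus)
qed

text \<open>
  The two angles add up to \<open>pi / 2\<close>, so with \<open>u = pi / 4 - t\<close> the left-hand side is
  \<open>cot u + tan u = 1 / (sin u * cos u)\<close>. This writes the secant through cotangents, for which
  the reflection formula applies.
\<close>

lemma cot_add_cot_sec:
  fixes t :: complex
  assumes "cos (2 * t) \<noteq> 0"
  shows "cot (of_real pi / 4 - t) + cot (of_real pi / 4 + t) = 2 / cos (2 * t)"
proof -
  define u :: complex where "u = of_real pi / 4 - t"
  have v: "of_real pi / 4 + t = of_real pi / 2 - u" by (simp add: u_def)
  have "cos (2 * t) = sin (of_real pi / 2 - 2 * t)" by (metis of_real_divide of_real_numeral cos_sin_eq)
  also have "of_real pi / 2 - 2 * t = 2 * u" by (simp add: u_def)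
  finally have c: "cos (2 * t) = 2 * sin u * cos u" by (simp add: sin_double)
  have sc: "sin (of_real pi / 2 - u) = cos u" "cos (of_real pi / 2 - u) = sin u"
    by (metis cos_sin_eq) (metis sin_cos_eq)
  have "cot u + cot (of_real pi / 2 - u) = 2 / (2 * sin u * cos u)"
    using assms sin_cos_squared_add[of u] unfolding c cot_def sc 
    by (simp add: divide_simps power2_eq_square)
  thus ?thesis unfolding v c u_def[symmetric] .
qed

lemma not_Int_if_Re:
  assumes "0 < Re z" "Re z < 1"
  shows "z \<notin> \<int>"
  using assms by (auto elim!: Ints_cases)

text \<open>
  On the unit disc the argument \<open>t = \<i> w / (2 pi)\<close> stays so small that \<open>1/4 \<plusminus> t\<close> and
  \<open>3/4 \<plusminus> t\<close> keep positive real part and avoid the poles of the Digamma function.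
\<close>

lemma abs_Re_less_quarter:
  fixes w :: complex
  assumes "norm w < 1"
  shows "\<bar>Re (\<i> / (2 * of_real pi) * w)\<bar> < 1 / 4"
proof -
  have "norm (\<i> / (2 * of_real pi) * w) = norm w / (2 * pi)"
    by (simp add: norm_divide norm_mult)
  also have "\<dots> < 1 / 4" using assms pi_gt3 by (simp add: field_simps)
  finally show ?thesis by (rule order.strict_trans1[OF abs_Re_le_cmod])
qed

text \<open>
  Here \<open>cosh w = cos (2 * pi * c * w)\<close>, so this is the secant formula above with
  \<open>t = pi * c * w\<close> after both cotangents have been replaced by the reflection formula.
\<close>

lemma sech_eq_Digamma:
  fixes w :: complex
  assumes "norm w < 1"
  defines "c \<equiv> \<i> / (2 * of_real pi)"
  shows "1 / cosh w = 1 / (2 * of_real pi) *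
    ((Digamma (c * w + 3/4) - Digamma (- c * w + 1/4)) + (Digamma (- c * w + 3/4) - Digamma (c * w + 1/4)))"
proof -
  define t where "t = c * w"
  have Re: "\<bar>Re t\<bar> < 1 / 4" unfolding t_def c_def by (rule abs_Re_less_quarter[OF assms(1)])
  have "2 * (of_real pi * t) = \<i> * w" by (simp add: t_def c_def)
  hence cosh: "cos (2 * (of_real pi * t)) = cosh w" by (simp add: cosh_conv_cos)
  have nz: "cosh w \<noteq> 0"
  proof
    assume "cosh w = 0"
    then obtain n :: int where "2 * (of_real pi * t) = of_real (of_int n * pi) + of_real pi / 2"
      unfolding cosh[symmetric] cos_eq_0 by blast
    hence "2 * (2 * (of_real pi * t)) = 2 * (of_real (of_int n * pi) + of_real pi / 2)" by simp
    hence "of_real (pi * 4) * t = of_real (pi * (2 * of_int n + 1))"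
      by (simp add: distrib_left mult_ac)
    from arg_cong[OF this, of Re] have "pi * (4 * Re t) = pi * (2 * of_int n + 1)"
      by simp
    hence "4 * Re t = 2 * of_int n + 1" by (subst (asm) mult_left_cancel) auto
    with Re have "\<bar>real_of_int (2 * n + 1)\<bar> < 1" by simp
    hence "\<bar>2 * n + 1\<bar> < 1" by linarith
    thus False by presburger
  qed
  have d1: "Digamma (- t + 3/4) - Digamma (t + 1/4) = of_real pi * cot (of_real pi / 4 + of_real pi * t)"
    using Digamma_reflection[OF not_Int_if_Re, of "t + 1/4"] Re by (simp add: algebra_simps)
  have d2: "Digamma (t + 3/4) - Digamma (- t + 1/4) = of_real pi * cot (of_real pi / 4 - of_real pi * t)"
    using Digamma_reflection[OF not_Int_if_Re, of "- t + 1/4"] Re by (simp add: algebra_simps)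
  have "(Digamma (t + 3/4) - Digamma (- t + 1/4)) + (Digamma (- t + 3/4) - Digamma (t + 1/4)) = 
     of_real pi * (2 / cosh w)"
    unfolding d1 d2 using cot_add_cot_sec[of "of_real pi * t"] nz
    unfolding distrib_left[symmetric] cosh by simp
  thus ?thesis unfolding mult_minus_left t_def[symmetric] by simp
qed

text \<open>
  Comparison of the derivatives of order \<open>2 r\<close> at the origin in the Digamma formula for
  \<open>1 / cosh\<close>. For even order the signs of \<open>c\<close> and \<open>- c\<close> agree, and the four terms pair up.
\<close>

lemma euler_number_even_Polygamma:
  "Polygamma (2 * r) (3/4) - Polygamma (2 * r) (1/4) 
    = (- 1) ^ r * 2 ^ (2 * r) * of_real pi ^ (2 * r + 1) * euler_number (2 * r)"
proof -
  define n where "n = 2 * r"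
  define c :: complex where "c = \<i> / (2 * of_real pi)"
  have Re: "\<bar>Re (c * w)\<bar> < 1 / 4" if "norm w < 1" for w
    unfolding c_def by (rule abs_Re_less_quarter[OF that])
  have hol: "Polygamma 0 holomorphic_on {z. Re z > 0}"
    by (rule holomorphic_on_Polygamma) (auto elim!: nonpos_Ints_cases)
  have D: "(deriv ^^ n) (\<lambda>w. Digamma (u * w + a)) 0 = u ^ n * Polygamma n a"
    and A: "(\<lambda>w. Digamma (u * w + a)) analytic_on {0}"
    if u: "u = c \<or> u = - c" and a: "a = 1/4 \<or> a = 3/4" for u a
  proof -
    have pos: "Re (u * w + a) > 0" if "w \<in> ball 0 1" for w
    proof -
      have "\<bar>Re (u * w)\<bar> < 1 / 4" using u Re[of w] that by (auto simp del: times_complex.sel)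
      moreover have "Re a \<ge> 1 / 4" using a by (elim disjE; hypsubst; simp)
      ultimately show ?thesis unfolding plus_complex.sel by linarith
    qed
    have "(deriv ^^ n) (\<lambda>w. Digamma (u * w + a)) 0 = u ^ n * (deriv ^^ n) Digamma (u * 0 + a)"
      by (rule higher_deriv_compose_linear'[OF hol, of "ball 0 1"])
         (use pos in \<open>auto intro: open_halfspace_Re_gt\<close>)
    moreover have na: "a \<notin> \<int>\<^sub>\<le>\<^sub>0" using pos[of 0] by (auto elim!: nonpos_Ints_cases)
    ultimately show "(deriv ^^ n) (\<lambda>w. Digamma (u * w + a)) 0 = u ^ n * Polygamma n a"
      by (simp add: higher_deriv_Polygamma)
    show "(\<lambda>w. Digamma (u * w + a)) analytic_on {0}"
      using na by (intro analytic_intros) auto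
  qed
  have u: "c = c \<or> c = - c" "- c = c \<or> - c = - c"
    and a: "1/4 = 1/4 \<or> 1/4 = (3/4 :: complex)" "3/4 = 1/4 \<or> 3/4 = (3/4 :: complex)"
    by auto
  note A1 = A[OF u(1) a(2)] and A2 = A[OF u(2) a(1)] and A3 = A[OF u(2) a(2)] and A4 = A[OF u(1) a(1)]
  note D1 = D[OF u(1) a(2)] and D2 = D[OF u(2) a(1)] and D3 = D[OF u(2) a(2)] and D4 = D[OF u(1) a(1)]
  note A12 = analytic_on_diff[OF A1 A2] and A34 = analytic_on_diff[OF A3 A4]
  have ev: "eventually (\<lambda>w. w \<in> ball (0 :: complex) 1) (nhds 0)"
    by (rule eventually_nhds_in_open) auto
  have "euler_number n = (deriv ^^ n) (\<lambda>z. 1 / cosh z) 0"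
    by (simp add: euler_number_def fps_expansion_def)
  also have "\<dots> = (deriv ^^ n) (\<lambda>w. 1 / (2 * of_real pi) * ((Digamma (c * w + 3/4) - Digamma (- c * w + 1/4)) +
       (Digamma (- c * w + 3/4) - Digamma (c * w + 1/4)))) 0"
  proof (rule higher_deriv_cong_ev)
    show "\<forall>\<^sub>F w in nhds 0. 1 / cosh w = 1 / (2 * of_real pi) * ((Digamma (c * w + 3/4) - Digamma (- c * w + 1/4)) +
       (Digamma (- c * w + 3/4) - Digamma (c * w + 1/4)))"
      using ev
      by eventually_elim (use sech_eq_Digamma in \<open>auto simp: c_def\<close>)
  qed auto
  also have "\<dots> = 1 / (2 * of_real pi) * ((c ^ n * Polygamma n (3/4) - (- c) ^ n * Polygamma n (1/4)) +
      ((- c) ^ n * Polygamma n (3/4) - c ^ n * Polygamma n (1/4)))"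
    by (simp only: higher_deriv_cmult'[OF analytic_on_add[OF A12 A34]] higher_deriv_add_at[OF A12 A34]
          higher_deriv_diff_at[OF A1 A2] higher_deriv_diff_at[OF A3 A4] D1 D2 D3 D4)
  also have "\<dots> = c ^ n / of_real pi * (Polygamma n (3/4) - Polygamma n (1/4))"
    by (simp add: n_def algebra_simps)
  finally have "euler_number n = c ^ n / of_real pi * (Polygamma n (3/4) - Polygamma n (1/4))" .
  moreover have "c ^ n = (- 1) ^ r / (2 * of_real pi) ^ n"
  proof -
    have "c\<^sup>2 = (- 1) / (2 * of_real pi)\<^sup>2" by (simp add: c_def power_divide)
    thus ?thesis by (simp only: n_def power_mult power_divide)
  qed
  ultimately have "(- 1) ^ r * 2 ^ n * of_real pi ^ (n + 1) * euler_number n =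
      ((- 1) ^ r * (- 1) ^ r) * (Polygamma n (3/4) - Polygamma n (1/4))"
    by (simp add: power_mult_distrib)
  also have "(- 1) ^ r * (- 1) ^ r = (1 :: complex)"
    by (simp flip: power_mult_distrib)
  finally show ?thesis by (simp add: n_def)
qed

text \<open>
  For \<open>n = 0\<close> the two series diverge separately, but their logarithmically divergent parts
  cancel; including this case covers the conditionally convergent series
  \<open>\<Sum>k. (- 1) ^ k / (k + 1/2)\<close> together with the others.
\<close>

lemma sums_inverse_power_diff_Polygamma:
  fixes x y :: complex
  assumes "x \<noteq> 0" "y \<noteq> 0"
  shows "(\<lambda>j. 1 / (x + of_nat j) ^ Suc n - 1 / (y + of_nat j) ^ Suc n) sums
     ((- 1) ^ n * (Polygamma n y - Polygamma n x) / fact n)"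
proof (cases "n = 0")
  case True
  have "(\<lambda>m. (of_real (ln (real m)) - (\<Sum>n<m. inverse (y + of_nat n))) - (of_real (ln (real m)) - (\<Sum>n<m. inverse (x + of_nat n))))
     \<longlonglongrightarrow> Digamma y - Digamma x"
    by (intro tendsto_diff Digamma_LIMSEQ assms)
  thus ?thesis using True by (simp add: sums_def sum_subtractf inverse_eq_divide)
next
  case False
  hence "(\<lambda>j. inverse ((x + of_nat j) ^ Suc n) - inverse ((y + of_nat j) ^ Suc n)) sums
     ((- 1) ^ Suc n * Polygamma n x / fact n - (- 1) ^ Suc n * Polygamma n y / fact n)"
    by (intro sums_diff Polygamma_LIMSEQ assms) auto
  thus ?thesis by (simp add: inverse_eq_divide diff_divide_distrib right_diff_distrib)
qed

lemma summable_alternating_half_power: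
  "summable (\<lambda>k. (- 1) ^ k / (of_nat k + 1 / 2 :: complex) ^ Suc n)"
proof -
  have "summable (\<lambda>k. (- 1) ^ k * (1 / (real k + 1 / 2) ^ Suc n))"
  proof (rule summable_Leibniz(1))
    show "(\<lambda>k. 1 / (real k + 1 / 2) ^ Suc n) \<longlonglongrightarrow> 0"
      by real_asymp
    have "1 / (real (Suc k) + 1 / 2) ^ Suc n \<le> 1 / (real k + 1 / 2) ^ Suc n" for k
      by (intro divide_left_mono power_mono mult_pos_pos zero_less_power) auto
    thus "monoseq (\<lambda>k. 1 / (real k + 1 / 2) ^ Suc n)"
      by (intro decseq_imp_monoseq) (simp add: decseq_Suc_iff)
  qed
  hence "summable (\<lambda>k. complex_of_real ((- 1) ^ k * (1 / (real k + 1 / 2) ^ Suc n)))"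
    by (rule summable_of_real)
  thus ?thesis by simp
qed

text \<open>
  Grouping the terms with \<open>k = 2 j\<close> and \<open>k = 2 j + 1\<close> gives \<open>2 ^ - (2 r + 1)\<close> times a difference of
  inverse powers of \<open>1/4 + j\<close> and \<open>3/4 + j\<close>. Grouping is harmless, since the ungrouped series
  is already known to converge.
\<close>

lemma sums_alternating_half_power:
  "(\<lambda>k. (- 1) ^ k / (of_nat k + 1 / 2) ^ (2 * r + 1)) sums
     ((- 1) ^ r * of_real pi ^ (2 * r + 1) * euler_number (2 * r) / (2 * fact (2 * r)))"
proof -
  let ?f = "\<lambda>k. (- 1) ^ k / (of_nat k + 1 / 2 :: complex) ^ (2 * r + 1)"
  have "?f sums suminf ?f"
    using summable_alternating_half_power[of "2 * r"] by (intro summable_sums) simp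
  hence "(\<lambda>j. sum ?f {j * 2 ..< j * 2 + 2}) sums suminf ?f" by (rule sums_group) auto
  moreover have "sum ?f {j * 2 ..< j * 2 + 2} = 
     (1 / (1/4 + of_nat j) ^ Suc (2 * r) - 1 / (3/4 + of_nat j) ^ Suc (2 * r)) / 2 ^ (2 * r + 1)" for j
  proof -
    have "{j * 2 ..< j * 2 + 2} = {j * 2, j * 2 + 1}" by auto
    hence "sum ?f {j * 2 ..< j * 2 + 2} = 
       1 / (of_nat (j * 2) + 1 / 2) ^ (2 * r + 1) - 1 / (of_nat (j * 2 + 1) + 1 / 2) ^ (2 * r + 1)" by simp
    also have "of_nat (j * 2) + 1 / 2 = (2 :: complex) * (1/4 + of_nat j)" by simp
    also have "of_nat (j * 2 + 1) + 1 / 2 = (2 :: complex) * (3/4 + of_nat j)" by simp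
    finally show ?thesis by (simp only: power_mult_distrib diff_divide_distrib) (simp add: mult_ac)
  qed
  moreover have "(\<lambda>j. (1 / (1/4 + of_nat j :: complex) ^ Suc (2 * r) - 1 / (3/4 + of_nat j) ^ Suc (2 * r)) / 2 ^ (2 * r + 1))
    sums ((- 1) ^ (2 * r) * (Polygamma (2 * r) (3/4) - Polygamma (2 * r) (1/4)) / fact (2 * r) / 2 ^ (2 * r + 1))"
    by (intro sums_divide sums_inverse_power_diff_Polygamma) auto
  ultimately have "suminf ?f = (Polygamma (2 * r) (3/4) - Polygamma (2 * r) (1/4)) / fact (2 * r) / 2 ^ (2 * r + 1)"
    using sums_unique2 by (simp del: power_Suc)
  also have "\<dots> = ((- 1) ^ r * of_real pi ^ (2 * r + 1) * euler_number (2 * r) / (2 * fact (2 * r)))"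
    unfolding euler_number_even_Polygamma by (simp add: mult_ac)
  finally show ?thesis using \<open>?f sums suminf ?f\<close> by simp
qed

section \<open>The series of exponential integrals\<close>

lemma exp_half_integer:
  fixes k :: nat
  defines "z \<equiv> \<i> * of_real pi * (of_nat k + 1 / 2)"
  shows "exp z = \<i> * (- 1) ^ k" and "exp (- z) = - \<i> * (- 1) ^ k"
proof -
  have "z = of_nat k * (\<i> * of_real pi) + \<i> * of_real pi / 2" by (simp add: z_def algebra_simps)
  hence "exp z = exp (\<i> * of_real pi) ^ k * exp (\<i> * of_real pi / 2)"
    by (simp only: exp_add exp_of_nat_mult)
  also have "exp (\<i> * of_real pi / 2) = \<i>"
    using cis_pi_half by (simp add: cis_conv_exp)
  finally show "exp z = \<i> * (- 1) ^ k" by simp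
  thus "exp (- z) = - \<i> * (- 1) ^ k" by (simp add: exp_minus flip: power_inverse)
qed

lemma sum_atMost_even_codistance:
  fixes f :: "nat \<Rightarrow> 'a :: comm_monoid_add"
  assumes "\<And>l. l \<le> p \<Longrightarrow> odd (p - l) \<Longrightarrow> f l = 0"
  shows "(\<Sum>l\<le>p. f l) = (\<Sum>q\<le>p div 2. f (p - 2 * q))"
proof -
  have inj: "inj_on (\<lambda>q. p - 2 * q) {..p div 2}" by (auto simp: inj_on_def)
  have "(\<Sum>l\<le>p. f l) = sum f ((\<lambda>q. p - 2 * q) ` {..p div 2})"
  proof (rule sum.mono_neutral_right)
    show "\<forall>l\<in>{..p} - (\<lambda>q. p - 2 * q) ` {..p div 2}. f l = 0"
    proof
      fix l assume l: "l \<in> {..p} - (\<lambda>q. p - 2 * q) ` {..p div 2}"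
      have "odd (p - l)"
      proof
        assume "even (p - l)"
        then obtain q where "p - l = 2 * q" by (elim evenE)
        hence "l = p - 2 * q" "q \<in> {..p div 2}" using l by auto
        thus False using l by auto
      qed
      thus "f l = 0" using assms l by auto
    qed
  qed auto
  also have "\<dots> = (\<Sum>q\<le>p div 2. f (p - 2 * q))" by (simp add: sum.reindex[OF inj])
  finally show ?thesis .
qed

text \<open>
  For \<open>z = \<i> pi x\<close> the two exponentials are \<open>\<mp>\<i> (- 1) ^ k\<close>, and the coefficient of
  \<open>1 / z ^ (l + 1)\<close> acquires the factor \<open>(- 1) ^ p + (- 1) ^ l\<close>: only the exponents \<open>l = p - 2 q\<close>
  survive.
\<close>

lemma exp_integral_pair:
  fixes k p :: nat
  defines "x \<equiv> of_nat k + 1 / 2 :: complex"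
  shows "(- 1) ^ p * exp_integral (- of_nat p) (\<i> * of_real pi * x)
           + exp_integral (- of_nat p) (- \<i> * of_real pi * x)
    = (\<Sum>q\<le>p div 2. - 2 * \<i> * (- 1) ^ p * fact p / fact (2 * q)
          / (\<i> * of_real pi) ^ (p - 2 * q + 1) * ((- 1) ^ k / x ^ (p - 2 * q + 1)))"
proof -
  define z where "z = \<i> * of_real pi * x"
  have x: "Im x = 0" "x \<noteq> 0"
    by (auto simp: x_def complex_eq_iff)
  have z: "Re z = 0" "z \<noteq> 0" using x by (auto simp: z_def)
  have e: "exp z = \<i> * (- 1) ^ k" "exp (- z) = - \<i> * (- 1) ^ k"
    unfolding z_def x_def by (rule exp_half_integer)+
  let ?f = "\<lambda>l. - \<i> * (- 1) ^ k * ((- 1) ^ p + (- 1) ^ l) * (fact p / fact (p - l) / z ^ (l + 1))"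
  have "exp_integral (- of_nat p) z = - \<i> * (- 1) ^ k * (\<Sum>l\<le>p. fact p / fact (p - l) / z ^ (l + 1))"
    using exp_integral_neg_nat[of z p] z e by simp
  moreover have "exp_integral (- of_nat p) (- z) = \<i> * (- 1) ^ k * (\<Sum>l\<le>p. fact p / fact (p - l) / (- z) ^ (l + 1))"
    using exp_integral_neg_nat[of "- z" p] z e by simp
  moreover have "(- z) ^ (l + 1) = - ((- 1) ^ l * z ^ (l + 1))" for l
    by (subst power_minus) simp
  ultimately have "(- 1) ^ p * exp_integral (- of_nat p) z + exp_integral (- of_nat p) (- z) = (\<Sum>l\<le>p. ?f l)"
    by (simp only: sum_distrib_left sum.distrib [symmetric], intro sum.cong refl)
       (auto simp: divide_simps algebra_simps uminus_power_if)
  also have "\<dots> = (\<Sum>q\<le>p div 2. ?f (p - 2 * q))"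
    by (rule sum_atMost_even_codistance) (auto simp: uminus_power_if)
  also have "\<dots> = (\<Sum>q\<le>p div 2. - 2 * \<i> * (- 1) ^ p * fact p / fact (2 * q)
          / (\<i> * of_real pi) ^ (p - 2 * q + 1) * ((- 1) ^ k / x ^ (p - 2 * q + 1)))"
  proof (rule sum.cong)
    fix q assume "q \<in> {..p div 2}"
    hence q: "2 * q \<le> p" by auto
    have 1: "(- 1) ^ (p - 2 * q) = ((- 1) ^ p :: complex)" using q by (simp add: uminus_power_if)
    have 2: "p - (p - 2 * q) = 2 * q" using q by simp
    show "?f (p - 2 * q) = - 2 * \<i> * (- 1) ^ p * fact p / fact (2 * q)
          / (\<i> * of_real pi) ^ (p - 2 * q + 1) * ((- 1) ^ k / x ^ (p - 2 * q + 1))"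
      unfolding 1 2 z_def power_mult_distrib[of _ x] by (simp add: mult_ac)
  qed auto
  finally show ?thesis by (simp add: z_def)
qed

text \<open>
  With \<open>p = d + 2 q\<close> and \<open>m = j + q\<close> all powers of \<open>pi\<close> cancel, the powers of \<open>\<i>\<close> leave
  \<open>- \<i> * \<i> ^ (- 1) = - 1\<close>, and every remaining sign occurs squared.
\<close>

lemma prefactor_times_coefficient:
  fixes p m q :: nat and y :: complex
  assumes "2 * q \<le> p" "p \<le> 2 * m"
  shows "of_real pi powi (int p - 2 * int m) * (- 1) ^ m * exp (- \<i> * of_real pi * of_nat p / 2)
       / Gamma (1 + of_nat p) * 
     (- 2 * \<i> * (- 1) ^ p * fact p / fact (2 * q) / (\<i> * of_real pi) ^ (p - 2 * q + 1) *
      ((- 1) ^ (m - q) * of_real pi ^ (2 * (m - q) + 1) * y / (2 * fact (2 * (m - q)))))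
    = - (y / (fact (2 * q) * fact (2 * (m - q))))"
proof -
  define d j where "d = p - 2 * q" and "j = m - q"
  have p: "p = d + 2 * q" and m: "m = j + q" using assms by (auto simp: d_def j_def)
  have P: "of_real pi powi (int p - 2 * int m) = (of_real pi :: complex) ^ d / of_real pi ^ (2 * j)"
  proof -
    have "int p - 2 * int m = int d - int (2 * j)" by (simp add: p m)
    thus ?thesis by (simp only: power_int_diff of_real_eq_0_iff pi_neq_zero power_int_of_nat simp_thms if_False)
  qed
  have "exp (- \<i> * of_real pi * of_nat p / 2) = exp (of_nat p * (- \<i> * of_real pi / 2))" by (simp add: mult_ac)
  also have "\<dots> = exp (- \<i> * of_real pi / 2) ^ p" by (rule exp_of_nat_mult)
  also have "exp (- \<i> * of_real pi / 2) = - \<i>"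
    using exp_half_integer(2)[of 0] by simp
  also have "(- \<i>) ^ p = (- 1) ^ d * \<i> ^ d * (- 1) ^ q"
    unfolding p power_add power_mult by (simp add: power_minus[of \<i>])
  finally have E: "exp (- \<i> * of_real pi * of_nat p / 2) = (- 1) ^ d * \<i> ^ d * (- 1) ^ q" .
  have G: "Gamma (1 + of_nat p) = (fact p :: complex)" by (rule Gamma_fact)
  have S: "(- 1) ^ p = ((- 1) ^ d :: complex)" "(- 1) ^ m = ((- 1) ^ j * (- 1) ^ q :: complex)"
    by (simp_all add: p m power_add power_mult)
  \<comment> \<open>The cancellation with the powers abstracted: \<open>A, B, I\<close> stand for \<open>pi ^ d, pi ^ (2 * j), \<i> ^ d\<close>,
     the letters \<open>F, F2, F3\<close> for the factorials, and \<open>s, t, u\<close> for the signs with exponents \<open>d, j, q\<close>.\<close>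
  have alg: "A / B * (t * u) * (s * I * u) / F * (- 2 * \<i> * s * F / F2 / (I * A * (\<i> * P)) * (t * (B * P) * y / (2 * F3)))
      = - ((s * s) * (t * t) * (u * u) * y / (F2 * F3))"
    if "A \<noteq> 0" "B \<noteq> 0" "P \<noteq> 0" "I \<noteq> 0" "F \<noteq> 0"
    for A B P I F F2 F3 s t u :: complex
    using that by simp
  have sq: "(- 1) ^ i * (- 1) ^ i = (1 :: complex)" for i :: nat
    by (simp flip: power_mult_distrib)
  show ?thesis
    unfolding P E G S d_def[symmetric] j_def[symmetric] power_mult_distrib[of \<i>] power_add power_one_right
    by (subst alg) (simp_all add: sq)
qed

lemma lower_summation_bound:
  "nat \<lfloor>- (real p / 2) + real m + 1 / 2\<rfloor> = m - p div 2"
proof -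
  have "\<lfloor>- (real p / 2) + real m + 1 / 2\<rfloor> = int m - int (p div 2)"
  proof (cases "even p")
    case True
    then obtain q where "p = 2 * q" by (elim evenE)
    thus ?thesis by (simp add: floor_eq_iff)
  next
    case False
    then obtain q where "p = 2 * q + 1" by (elim oddE)
    thus ?thesis by (simp add: floor_eq_iff add_divide_distrib)
  qed
  thus ?thesis by simp
qed

theorem mainTheorem4:
  fixes m p :: nat and a :: "nat \<Rightarrow> complex"
  assumes "p \<le> 2 * m"
  defines "a \<equiv> \<lambda>k.
     ((- 1) ^ p * exp_integral (- of_nat p) (\<i> * of_real pi * (of_nat k + 1 / 2))
        + exp_integral (- of_nat p) (- \<i> * of_real pi * (of_nat k + 1 / 2)))
     / (of_nat k + 1 / 2) ^ (2 * m - p)"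
  shows "summable a \<and>
     of_real pi powi (int p - 2 * int m) * (- 1) ^ m * exp (- \<i> * of_real pi * of_nat p / 2)
       / Gamma (1 + of_nat p) * (\<Sum>k. a k)
     = - (\<Sum>j = nat \<lfloor>- (real p / 2) + real m + 1 / 2\<rfloor>..m.
            euler_number (2 * j)
              / (Gamma (2 * of_nat m - 2 * of_nat j + 1) * Gamma (2 * of_nat j + 1)))"
proof -
  \<comment> \<open>\<open>C q\<close> collects what does not depend on \<open>k\<close> in the \<open>q\<close>-th surviving term; \<open>B r\<close> is the value of the
     alternating series with exponent \<open>2 * r + 1\<close>.\<close>
  define C where "C = (\<lambda>q. - 2 * \<i> * (- 1) ^ p * fact p / fact (2 * q) / (\<i> * of_real pi) ^ (p - 2 * q + 1))"
  define B :: "nat \<Rightarrow> complex" where "B = (\<lambda>r. (- 1) ^ r * of_real pi ^ (2 * r + 1) * euler_number (2 * r) / (2 * fact (2 * r)))"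
  have "a = (\<lambda>k. \<Sum>q\<le>p div 2. C q * ((- 1) ^ k / (of_nat k + 1 / 2) ^ (2 * (m - q) + 1)))"
  proof
    fix k
    have "a k = (\<Sum>q\<le>p div 2. C q * ((- 1) ^ k / (of_nat k + 1 / 2) ^ (p - 2 * q + 1)) / (of_nat k + 1 / 2) ^ (2 * m - p))"
      unfolding a_def exp_integral_pair sum_divide_distrib C_def ..
    also have "\<dots> = (\<Sum>q\<le>p div 2. C q * ((- 1) ^ k / (of_nat k + 1 / 2) ^ (2 * (m - q) + 1)))"
    proof (rule sum.cong)
      fix q assume "q \<in> {..p div 2}"
      hence "2 * (m - q) + 1 = (p - 2 * q + 1) + (2 * m - p)" using assms(1) by auto
      thus "C q * ((- 1) ^ k / (of_nat k + 1 / 2) ^ (p - 2 * q + 1)) / (of_nat k + 1 / 2) ^ (2 * m - p)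
         = C q * ((- 1) ^ k / (of_nat k + 1 / 2) ^ (2 * (m - q) + 1))"
        by (simp only: power_add[of _ "p - 2 * q + 1"]) (simp del: power_Suc)
    qed auto
    finally show "a k = (\<Sum>q\<le>p div 2. C q * ((- 1) ^ k / (of_nat k + 1 / 2) ^ (2 * (m - q) + 1)))" .
  qed
  moreover have "(\<lambda>k. \<Sum>q\<le>p div 2. C q * ((- 1) ^ k / (of_nat k + 1 / 2) ^ (2 * (m - q) + 1)))
      sums (\<Sum>q\<le>p div 2. C q * B (m - q))"
    unfolding B_def by (intro sums_sum sums_mult sums_alternating_half_power)
  ultimately have sums: "a sums (\<Sum>q\<le>p div 2. C q * B (m - q))" by simp
  have "of_real pi powi (int p - 2 * int m) * (- 1) ^ m * exp (- \<i> * of_real pi * of_nat p / 2)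
       / Gamma (1 + of_nat p) * (\<Sum>k. a k)
     = (\<Sum>q\<le>p div 2. - (euler_number (2 * (m - q)) / (fact (2 * q) * fact (2 * (m - q)))))"
    unfolding sums_unique[OF sums, symmetric] sum_distrib_left C_def B_def
    by (intro sum.cong refl prefactor_times_coefficient) (use assms(1) in auto)
  also have "\<dots> = - (\<Sum>q\<le>p div 2. euler_number (2 * (m - q)) / (fact (2 * q) * fact (2 * (m - q))))"
    by (rule sum_negf)
  also have "(\<Sum>q\<le>p div 2. euler_number (2 * (m - q)) / (fact (2 * q) * fact (2 * (m - q)))) =
    (\<Sum>j = m - p div 2..m. euler_number (2 * j)
              / (Gamma (2 * of_nat m - 2 * of_nat j + 1) * Gamma (2 * of_nat j + 1)))"
  proof (rule sum.reindex_bij_witness[of _ "\<lambda>j. m - j" "\<lambda>q. m - q"])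
    fix q assume q: "q \<in> {..p div 2}"
    hence "q \<le> m" using assms(1) by auto
    hence "2 * of_nat m - 2 * of_nat (m - q) + 1 = 1 + (of_nat (2 * q) :: complex)"
      by (simp add: of_nat_diff algebra_simps)
    moreover have "2 * of_nat (m - q) + 1 = 1 + (of_nat (2 * (m - q)) :: complex)"
      by simp
    ultimately show "euler_number (2 * (m - q)) / (Gamma (2 * of_nat m - 2 * of_nat (m - q) + 1) * Gamma (2 * of_nat (m - q) + 1)) 
       = euler_number (2 * (m - q)) / (fact (2 * q) * fact (2 * (m - q)))"
      by (simp only: Gamma_fact)
  qed (use assms(1) in auto)
  finally show ?thesis
    unfolding lower_summation_bound using sums_summable[OF sums] by blast
qed

end
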